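(* For any set $I$ of unary function symbols, the variety $\mathsf{MV}(I)$ of MV(I)-algebras has the congruence extension property: for every $\mathbf{B}\in\mathsf{MV}(I)$, every subalgebra $\mathbf{A}$ of $\mathbf{B}$ and every congruence $\theta$ of $\mathbf{A}$, there is a congruence $\xi$ of $\mathbf{B}$ with $\xi\cap A^2=\theta$.
   Context: An MV(I)-algebra is an algebra $(A,\wedge,\vee,\cdot,\to,0,1,\{\Box\}_{\Box\in I})$ whose reduct $(A,\wedge,\vee,\cdot,\to,0,1)$ is an MV-algebra and in which each $\Box\in I$ is a $\{\wedge,\cdot,0,1\}$-endomorphism of that MV-algebra (i.e., $\Box(x\wedge y)=\Box x\wedge\Box y$, $\Box(xy)=\Box x\cdot\Box y$, $\Box0=0$, $\Box1=1$). *)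

theory Defs
  imports "HOL-Algebra.Group"
begin

text \<open>
  MV-algebras are presented in the residuated signature: bounded commutative integral residuated
  lattices satisfying \<open>(x \<leadsto> y) \<leadsto> y = x \<curlyvee> y\<close>. The monoid unit \<open>\<one>\<close> is the top element.
\<close>

record 'a mv_algebra = "'a monoid" +
  mv_meet :: "['a, 'a] \<Rightarrow> 'a" (infixl \<open>\<curlywedge>\<index>\<close> 65)
  mv_join :: "['a, 'a] \<Rightarrow> 'a" (infixl \<open>\<curlyvee>\<index>\<close> 65)
  mv_imp :: "['a, 'a] \<Rightarrow> 'a" (infixr \<open>\<leadsto>\<index>\<close> 60)
  mv_zero :: 'a (\<open>\<zero>\<index>\<close>)

record ('a, 'i) mvi_algebra = "'a mv_algebra" +
  mv_box :: "['i, 'a] \<Rightarrow> 'a" (\<open>\<box>\<index>\<close>)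

locale mv_algebra = comm_monoid A for A (structure) +
  assumes meet_closed: "\<lbrakk>x \<in> carrier A; y \<in> carrier A\<rbrakk> \<Longrightarrow> x \<curlywedge> y \<in> carrier A"
    and join_closed: "\<lbrakk>x \<in> carrier A; y \<in> carrier A\<rbrakk> \<Longrightarrow> x \<curlyvee> y \<in> carrier A"
    and imp_closed: "\<lbrakk>x \<in> carrier A; y \<in> carrier A\<rbrakk> \<Longrightarrow> (x \<leadsto> y) \<in> carrier A"
    and zero_closed: "\<zero> \<in> carrier A"
    and meet_comm: "\<lbrakk>x \<in> carrier A; y \<in> carrier A\<rbrakk> \<Longrightarrow> x \<curlywedge> y = y \<curlywedge> x"
    and join_comm: "\<lbrakk>x \<in> carrier A; y \<in> carrier A\<rbrakk> \<Longrightarrow> x \<curlyvee> y = y \<curlyvee> x"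
    and meet_assoc: "\<lbrakk>x \<in> carrier A; y \<in> carrier A; z \<in> carrier A\<rbrakk>
          \<Longrightarrow> (x \<curlywedge> y) \<curlywedge> z = x \<curlywedge> (y \<curlywedge> z)"
    and join_assoc: "\<lbrakk>x \<in> carrier A; y \<in> carrier A; z \<in> carrier A\<rbrakk>
          \<Longrightarrow> (x \<curlyvee> y) \<curlyvee> z = x \<curlyvee> (y \<curlyvee> z)"
    and meet_absorb: "\<lbrakk>x \<in> carrier A; y \<in> carrier A\<rbrakk> \<Longrightarrow> x \<curlywedge> (x \<curlyvee> y) = x"
    and join_absorb: "\<lbrakk>x \<in> carrier A; y \<in> carrier A\<rbrakk> \<Longrightarrow> x \<curlyvee> (x \<curlywedge> y) = x"
    and zero_least: "x \<in> carrier A \<Longrightarrow> \<zero> \<curlywedge> x = \<zero>"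
    and one_greatest: "x \<in> carrier A \<Longrightarrow> x \<curlywedge> \<one> = x"
    and residuation: "\<lbrakk>x \<in> carrier A; y \<in> carrier A; z \<in> carrier A\<rbrakk>
          \<Longrightarrow> (x \<otimes> y) \<curlywedge> z = x \<otimes> y \<longleftrightarrow> x \<curlywedge> (y \<leadsto> z) = x"
    and imp_imp_join: "\<lbrakk>x \<in> carrier A; y \<in> carrier A\<rbrakk> \<Longrightarrow> ((x \<leadsto> y) \<leadsto> y) = x \<curlyvee> y"

locale mvi_algebra = mv_algebra A for I :: "'i set" and A :: "('a, 'i, 'm) mvi_algebra_scheme" (structure) +
  assumes box_closed: "\<lbrakk>i \<in> I; x \<in> carrier A\<rbrakk> \<Longrightarrow> \<box> i x \<in> carrier A"
    and box_meet: "\<lbrakk>i \<in> I; x \<in> carrier A; y \<in> carrier A\<rbrakk> \<Longrightarrow> \<box> i (x \<curlywedge> y) = \<box> i x \<curlywedge> \<box> i y"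
    and box_mult: "\<lbrakk>i \<in> I; x \<in> carrier A; y \<in> carrier A\<rbrakk> \<Longrightarrow> \<box> i (x \<otimes> y) = \<box> i x \<otimes> \<box> i y"
    and box_zero: "i \<in> I \<Longrightarrow> \<box> i \<zero> = \<zero>"
    and box_one: "i \<in> I \<Longrightarrow> \<box> i \<one> = \<one>"

definition MV :: "'i set \<Rightarrow> ('a, 'i) mvi_algebra set" where
  "MV I = {A. mvi_algebra I A}"

text \<open>
  A subalgebra of \<open>B\<close> is given by its universe \<open>S\<close>; as an algebra it is \<open>B\<lparr>carrier := S\<rparr>\<close>.
\<close>

definition subalgebra :: "'i set \<Rightarrow> 'a set \<Rightarrow> ('a, 'i) mvi_algebra \<Rightarrow> bool" where
  "subalgebra I S B \<longleftrightarrow>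
     S \<subseteq> carrier B \<and> \<zero>\<^bsub>B\<^esub> \<in> S \<and> \<one>\<^bsub>B\<^esub> \<in> S \<and>
     (\<forall>x\<in>S. \<forall>y\<in>S. x \<curlywedge>\<^bsub>B\<^esub> y \<in> S \<and> x \<curlyvee>\<^bsub>B\<^esub> y \<in> S \<and> x \<otimes>\<^bsub>B\<^esub> y \<in> S \<and> (x \<leadsto>\<^bsub>B\<^esub> y) \<in> S) \<and>
     (\<forall>i\<in>I. \<forall>x\<in>S. \<box>\<^bsub>B\<^esub> i x \<in> S)"

definition congruence :: "'i set \<Rightarrow> ('a, 'i) mvi_algebra \<Rightarrow> ('a \<times> 'a) set \<Rightarrow> bool" where
  "congruence I A \<theta> \<longleftrightarrow>
     equiv (carrier A) \<theta> \<and>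
     (\<forall>(x, x')\<in>\<theta>. \<forall>(y, y')\<in>\<theta>.
        (x \<curlywedge>\<^bsub>A\<^esub> y, x' \<curlywedge>\<^bsub>A\<^esub> y') \<in> \<theta> \<and> (x \<curlyvee>\<^bsub>A\<^esub> y, x' \<curlyvee>\<^bsub>A\<^esub> y') \<in> \<theta> \<and>
        (x \<otimes>\<^bsub>A\<^esub> y, x' \<otimes>\<^bsub>A\<^esub> y') \<in> \<theta> \<and> (x \<leadsto>\<^bsub>A\<^esub> y, x' \<leadsto>\<^bsub>A\<^esub> y') \<in> \<theta>) \<and>
     (\<forall>i\<in>I. \<forall>(x, x')\<in>\<theta>. (\<box>\<^bsub>A\<^esub> i x, \<box>\<^bsub>A\<^esub> i x') \<in> \<theta>)"

definition congruence_extension_property :: "'i set \<Rightarrow> ('a, 'i) mvi_algebra set \<Rightarrow> bool" where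
  "congruence_extension_property I K \<longleftrightarrow>
     (\<forall>B\<in>K. \<forall>S \<theta>. subalgebra I S B \<longrightarrow> congruence I (B\<lparr>carrier := S\<rparr>) \<theta> \<longrightarrow>
        (\<exists>\<xi>. congruence I B \<xi> \<and> \<xi> \<inter> (S \<times> S) = \<theta>))"

end

theory Submission
  imports Defs
begin

text \<open>
  For a submonoid \<open>F\<close>, let \<open>x \<lesssim> y\<close> mean that \<open>g \<otimes> x \<preceq> y\<close> for some \<open>g \<in> F\<close>; this is inequality modulo
  the filter that \<open>F\<close> generates. For \<open>\<lesssim>\<close>, meet and join are still infimum and supremum and \<open>\<leadsto>\<close> is
  still the residual of \<open>\<otimes>\<close>, so all operations are monotone (antitone in the premise of \<open>\<leadsto>\<close>); so
  are the boxes if they map \<open>F\<close> into itself. Hence \<open>\<lesssim>\<close> and its converse intersect in a congruence,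
  and restricting it to a subalgebra that contains \<open>F\<close> gives the congruence of \<open>F\<close> there. Every
  congruence \<open>\<theta>\<close> of the subalgebra is of this form, with \<open>F\<close> its class of \<open>\<one>\<close>: factors in \<open>F\<close> vanish
  modulo \<open>\<theta>\<close>, and \<open>x \<leadsto> y\<close> witnesses \<open>x \<lesssim> y\<close> when \<open>(x, y) \<in> \<theta>\<close>.
\<close>

definition mv_le :: "('a, 'm) mv_algebra_scheme \<Rightarrow> 'a \<Rightarrow> 'a \<Rightarrow> bool" (infix \<open>\<preceq>\<index>\<close> 50)
  where "x \<preceq>\<^bsub>A\<^esub> y \<longleftrightarrow> x \<curlywedge>\<^bsub>A\<^esub> y = x"

definition filter_le :: "('a, 'm) mv_algebra_scheme \<Rightarrow> 'a set \<Rightarrow> ('a \<times> 'a) set" where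
  "filter_le A F = {(x, y). x \<in> carrier A \<and> y \<in> carrier A \<and> (\<exists>g\<in>F. g \<otimes>\<^bsub>A\<^esub> x \<preceq>\<^bsub>A\<^esub> y)}"

definition filter_congruence :: "('a, 'm) mv_algebra_scheme \<Rightarrow> 'a set \<Rightarrow> ('a \<times> 'a) set" where
  "filter_congruence A F = filter_le A F \<inter> (filter_le A F)\<inverse>"

section \<open>Commutative integral residuated lattices\<close>

locale integral_residuated_lattice =
  comm_monoid A for A :: "('a, 'm) mv_algebra_scheme" (structure) +
  assumes meet_closed: "\<lbrakk>x \<in> carrier A; y \<in> carrier A\<rbrakk> \<Longrightarrow> x \<curlywedge> y \<in> carrier A"
    and join_closed: "\<lbrakk>x \<in> carrier A; y \<in> carrier A\<rbrakk> \<Longrightarrow> x \<curlyvee> y \<in> carrier A"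
    and imp_closed: "\<lbrakk>x \<in> carrier A; y \<in> carrier A\<rbrakk> \<Longrightarrow> (x \<leadsto> y) \<in> carrier A"
    and meet_comm: "\<lbrakk>x \<in> carrier A; y \<in> carrier A\<rbrakk> \<Longrightarrow> x \<curlywedge> y = y \<curlywedge> x"
    and join_comm: "\<lbrakk>x \<in> carrier A; y \<in> carrier A\<rbrakk> \<Longrightarrow> x \<curlyvee> y = y \<curlyvee> x"
    and meet_assoc: "\<lbrakk>x \<in> carrier A; y \<in> carrier A; z \<in> carrier A\<rbrakk>
          \<Longrightarrow> (x \<curlywedge> y) \<curlywedge> z = x \<curlywedge> (y \<curlywedge> z)"
    and join_assoc: "\<lbrakk>x \<in> carrier A; y \<in> carrier A; z \<in> carrier A\<rbrakk>
          \<Longrightarrow> (x \<curlyvee> y) \<curlyvee> z = x \<curlyvee> (y \<curlyvee> z)"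
    and meet_absorb: "\<lbrakk>x \<in> carrier A; y \<in> carrier A\<rbrakk> \<Longrightarrow> x \<curlywedge> (x \<curlyvee> y) = x"
    and join_absorb: "\<lbrakk>x \<in> carrier A; y \<in> carrier A\<rbrakk> \<Longrightarrow> x \<curlyvee> (x \<curlywedge> y) = x"
    and le_one: "x \<in> carrier A \<Longrightarrow> x \<preceq> \<one>"
    and le_imp_iff: "\<lbrakk>x \<in> carrier A; y \<in> carrier A; z \<in> carrier A\<rbrakk>
          \<Longrightarrow> x \<preceq> (y \<leadsto> z) \<longleftrightarrow> x \<otimes> y \<preceq> z"

sublocale mv_algebra \<subseteq> integral_residuated_lattice A
  by unfold_locales
    (auto simp: mv_le_def meet_closed join_closed imp_closed meet_assoc join_assoc meet_absorb
      join_absorb one_greatest residuation intro: meet_comm join_comm)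

context integral_residuated_lattice
begin

lemmas op_closed = m_closed meet_closed join_closed imp_closed

lemma le_refl: "x \<in> carrier A \<Longrightarrow> x \<preceq> x"
  using meet_absorb[of x "x \<curlywedge> x"] join_absorb[of x x] by (simp add: mv_le_def meet_closed)

lemma le_trans:
  assumes "x \<preceq> y" "y \<preceq> z" "x \<in> carrier A" "y \<in> carrier A" "z \<in> carrier A"
  shows "x \<preceq> z"
  using assms meet_assoc[of x y z] by (simp add: mv_le_def)

lemma meet_le1: "\<lbrakk>x \<in> carrier A; y \<in> carrier A\<rbrakk> \<Longrightarrow> x \<curlywedge> y \<preceq> x"
  using le_refl[of x] meet_assoc[of x x y] meet_comm[of "x \<curlywedge> y" x]
  by (simp add: mv_le_def meet_closed)

lemma meet_le2: "\<lbrakk>x \<in> carrier A; y \<in> carrier A\<rbrakk> \<Longrightarrow> x \<curlywedge> y \<preceq> y"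
  using meet_le1[of y x] meet_comm[of x y] by simp

lemma le_meetI:
  assumes "z \<preceq> x" "z \<preceq> y" "x \<in> carrier A" "y \<in> carrier A" "z \<in> carrier A"
  shows "z \<preceq> x \<curlywedge> y"
  using assms meet_assoc[of z x y] by (simp add: mv_le_def)

lemma le_iff_join:
  assumes "x \<in> carrier A" "y \<in> carrier A"
  shows "x \<preceq> y \<longleftrightarrow> x \<curlyvee> y = y"
  unfolding mv_le_def
  using assms join_absorb[of y x] join_comm[of x y] meet_absorb[of x y] meet_comm[of x y] by auto

lemma le_join1: "\<lbrakk>x \<in> carrier A; y \<in> carrier A\<rbrakk> \<Longrightarrow> x \<preceq> x \<curlyvee> y"
  by (simp add: mv_le_def meet_absorb)

lemma le_join2: "\<lbrakk>x \<in> carrier A; y \<in> carrier A\<rbrakk> \<Longrightarrow> y \<preceq> x \<curlyvee> y"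
  using le_join1[of y x] join_comm[of x y] by simp

lemma join_leI:
  assumes "x \<preceq> z" "y \<preceq> z" "x \<in> carrier A" "y \<in> carrier A" "z \<in> carrier A"
  shows "x \<curlyvee> y \<preceq> z"
  using assms by (simp add: le_iff_join join_closed join_assoc)

lemma imp_mult_le: "\<lbrakk>x \<in> carrier A; y \<in> carrier A\<rbrakk> \<Longrightarrow> (x \<leadsto> y) \<otimes> x \<preceq> y"
  using le_imp_iff[of "x \<leadsto> y" x y] by (simp add: le_refl imp_closed)

lemma imp_self: "x \<in> carrier A \<Longrightarrow> (x \<leadsto> x) = \<one>"
  using le_imp_iff[of \<one> x x] le_refl[of x] le_one[of "x \<leadsto> x"] meet_comm[of \<one> "x \<leadsto> x"]
  by (simp add: mv_le_def imp_closed)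

lemma mult_right_mono:
  assumes "x \<preceq> y" "x \<in> carrier A" "y \<in> carrier A" "z \<in> carrier A"
  shows "x \<otimes> z \<preceq> y \<otimes> z"
proof -
  have "y \<preceq> (z \<leadsto> y \<otimes> z)"
    using assms by (simp add: le_imp_iff le_refl)
  then have "x \<preceq> (z \<leadsto> y \<otimes> z)"
    using assms by (blast intro: le_trans op_closed)
  then show ?thesis
    using assms by (simp add: le_imp_iff)
qed

lemma mult_left_mono:
  assumes "x \<preceq> y" "x \<in> carrier A" "y \<in> carrier A" "z \<in> carrier A"
  shows "z \<otimes> x \<preceq> z \<otimes> y"
  using mult_right_mono[OF assms] assms by (simp add: m_comm)

lemma mult_le1: "\<lbrakk>x \<in> carrier A; y \<in> carrier A\<rbrakk> \<Longrightarrow> x \<otimes> y \<preceq> x"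
  using mult_left_mono[of y \<one> x] by (simp add: le_one)

lemma mult_le2: "\<lbrakk>x \<in> carrier A; y \<in> carrier A\<rbrakk> \<Longrightarrow> x \<otimes> y \<preceq> y"
  using mult_le1[of y x] by (simp add: m_comm)

end

section \<open>The preorder and the congruence of a submonoid\<close>

locale residuated_lattice_submonoid =
  integral_residuated_lattice A + F: submonoid F A
  for A :: "('a, 'm) mv_algebra_scheme" (structure) and F
begin

abbreviation filter_less_eq (infix \<open>\<lesssim>\<close> 50) where
  "x \<lesssim> y \<equiv> (x, y) \<in> filter_le A F"

lemma filter_leI:
  "\<lbrakk>g \<otimes> x \<preceq> y; g \<in> F; x \<in> carrier A; y \<in> carrier A\<rbrakk> \<Longrightarrow> x \<lesssim> y"
  by (auto simp: filter_le_def)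

lemma filter_leE:
  assumes "x \<lesssim> y"
  obtains g where "g \<in> F" "g \<in> carrier A" "g \<otimes> x \<preceq> y" "x \<in> carrier A" "y \<in> carrier A"
  using assms by (auto simp: filter_le_def)

lemma filter_le_carrier: "x \<lesssim> y \<Longrightarrow> x \<in> carrier A" "x \<lesssim> y \<Longrightarrow> y \<in> carrier A"
  by (auto simp: filter_le_def)

lemma le_imp_filter_le: "\<lbrakk>x \<preceq> y; x \<in> carrier A; y \<in> carrier A\<rbrakk> \<Longrightarrow> x \<lesssim> y"
  using F.one_closed by (auto intro: filter_leI[of \<one>])

lemma filter_le_refl: "x \<in> carrier A \<Longrightarrow> x \<lesssim> x"
  by (simp add: le_imp_filter_le le_refl)

lemma filter_le_trans [trans]:
  assumes "x \<lesssim> y" "y \<lesssim> z"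
  shows "x \<lesssim> z"
proof -
  obtain g where g: "g \<in> F" "g \<in> carrier A" "g \<otimes> x \<preceq> y"
    and carr_xy: "x \<in> carrier A" "y \<in> carrier A"
    using assms(1) by (rule filter_leE)
  obtain h where h: "h \<in> F" "h \<in> carrier A" "h \<otimes> y \<preceq> z"
    and carr_z: "z \<in> carrier A"
    using assms(2) by (rule filter_leE)
  have "h \<otimes> (g \<otimes> x) \<preceq> h \<otimes> y"
    using g h carr_xy by (simp add: mult_left_mono)
  then have "h \<otimes> (g \<otimes> x) \<preceq> z"
    using g h carr_xy carr_z by (blast intro: le_trans op_closed)
  then show ?thesis
    using g h carr_xy carr_z by (intro filter_leI[of "h \<otimes> g"]) (simp_all add: m_assoc)
qed

lemma filter_le_common_witness:
  assumes "x \<lesssim> x'" "y \<lesssim> y'"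
  obtains g where "g \<in> F" "g \<in> carrier A" "g \<otimes> x \<preceq> x'" "g \<otimes> y \<preceq> y'"
proof -
  obtain g where g: "g \<in> F" "g \<in> carrier A" "g \<otimes> x \<preceq> x'"
    and carr_x: "x \<in> carrier A" "x' \<in> carrier A"
    using assms(1) by (rule filter_leE)
  obtain h where h: "h \<in> F" "h \<in> carrier A" "h \<otimes> y \<preceq> y'"
    and carr_y: "y \<in> carrier A" "y' \<in> carrier A"
    using assms(2) by (rule filter_leE)
  have "(g \<otimes> h) \<otimes> x \<preceq> g \<otimes> x" "(g \<otimes> h) \<otimes> y \<preceq> h \<otimes> y"
    using g h carr_x carr_y by (simp_all add: mult_right_mono mult_le1 mult_le2)
  then have "(g \<otimes> h) \<otimes> x \<preceq> x'" "(g \<otimes> h) \<otimes> y \<preceq> y'"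
    using g h carr_x carr_y by (meson le_trans op_closed)+
  then show thesis
    using that g h by blast
qed

lemma filter_le_meetI:
  assumes "z \<lesssim> x" "z \<lesssim> y"
  shows "z \<lesssim> x \<curlywedge> y"
proof -
  obtain g where "g \<in> F" "g \<in> carrier A" "g \<otimes> z \<preceq> x" "g \<otimes> z \<preceq> y"
    using filter_le_common_witness[OF assms] .
  then show ?thesis
    using assms[THEN filter_le_carrier(1)] assms[THEN filter_le_carrier(2)]
    by (intro filter_leI[of g]) (simp_all add: le_meetI meet_closed)
qed

lemma filter_join_leI:
  assumes "x \<lesssim> z" "y \<lesssim> z"
  shows "x \<curlyvee> y \<lesssim> z"
proof -
  note carr = assms[THEN filter_le_carrier(1)] assms[THEN filter_le_carrier(2)]
  obtain g where g: "g \<in> F" "g \<in> carrier A" "g \<otimes> x \<preceq> z" "g \<otimes> y \<preceq> z"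
    using filter_le_common_witness[OF assms] .
  then have "x \<preceq> (g \<leadsto> z)" "y \<preceq> (g \<leadsto> z)"
    using carr by (simp_all add: le_imp_iff m_comm)
  then have "x \<curlyvee> y \<preceq> (g \<leadsto> z)"
    using g carr by (simp add: join_leI imp_closed)
  then have "g \<otimes> (x \<curlyvee> y) \<preceq> z"
    using g carr by (simp add: le_imp_iff m_comm join_closed)
  then show ?thesis
    using g carr by (intro filter_leI[of g]) (simp_all add: join_closed)
qed

lemma filter_le_imp_iff:
  assumes "x \<in> carrier A" "y \<in> carrier A" "z \<in> carrier A"
  shows "x \<lesssim> (y \<leadsto> z) \<longleftrightarrow> x \<otimes> y \<lesssim> z"
  using assms by (auto simp: filter_le_def le_imp_iff m_assoc imp_closed)

lemma filter_le_meet_mono: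
  assumes "x \<lesssim> x'" "y \<lesssim> y'"
  shows "x \<curlywedge> y \<lesssim> x' \<curlywedge> y'"
proof (rule filter_le_meetI)
  note carr = assms[THEN filter_le_carrier(1)]
  show "x \<curlywedge> y \<lesssim> x'"
    using le_imp_filter_le[OF meet_le1] carr assms(1) by (blast intro: filter_le_trans meet_closed)
  show "x \<curlywedge> y \<lesssim> y'"
    using le_imp_filter_le[OF meet_le2] carr assms(2) by (blast intro: filter_le_trans meet_closed)
qed

lemma filter_le_join_mono:
  assumes "x \<lesssim> x'" "y \<lesssim> y'"
  shows "x \<curlyvee> y \<lesssim> x' \<curlyvee> y'"
proof (rule filter_join_leI)
  note carr = assms[THEN filter_le_carrier(2)]
  show "x \<lesssim> x' \<curlyvee> y'"
    using le_imp_filter_le[OF le_join1] carr assms(1) by (blast intro: filter_le_trans join_closed)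
  show "y \<lesssim> x' \<curlyvee> y'"
    using le_imp_filter_le[OF le_join2] carr assms(2) by (blast intro: filter_le_trans join_closed)
qed

lemma filter_le_mult_right_mono:
  assumes "x \<lesssim> y" "z \<in> carrier A"
  shows "x \<otimes> z \<lesssim> y \<otimes> z"
proof -
  note carr = assms(1)[THEN filter_le_carrier(1)] assms(1)[THEN filter_le_carrier(2)]
  note assms(1)
  also have "y \<lesssim> (z \<leadsto> y \<otimes> z)"
    using carr assms(2) by (intro le_imp_filter_le) (simp_all add: le_imp_iff le_refl imp_closed)
  finally show ?thesis
    using carr assms(2) by (simp add: filter_le_imp_iff)
qed

lemma filter_le_mult_mono:
  assumes "x \<lesssim> x'" "y \<lesssim> y'"
  shows "x \<otimes> y \<lesssim> x' \<otimes> y'"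
proof -
  note carr = assms[THEN filter_le_carrier(1)] assms[THEN filter_le_carrier(2)]
  have "x \<otimes> y \<lesssim> x' \<otimes> y"
    using assms(1) carr by (simp add: filter_le_mult_right_mono)
  also have "x' \<otimes> y \<lesssim> x' \<otimes> y'"
    using filter_le_mult_right_mono[OF assms(2), of x'] carr by (simp add: m_comm)
  finally show ?thesis .
qed

lemma filter_le_imp_mono:
  assumes "x' \<lesssim> x" "y \<lesssim> y'"
  shows "(x \<leadsto> y) \<lesssim> (x' \<leadsto> y')"
proof -
  note carr = assms[THEN filter_le_carrier(1)] assms[THEN filter_le_carrier(2)]
  have "(x \<leadsto> y) \<otimes> x' \<lesssim> (x \<leadsto> y) \<otimes> x"
    using assms(1) carr by (simp add: filter_le_mult_mono filter_le_refl imp_closed)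
  also have "(x \<leadsto> y) \<otimes> x \<lesssim> y"
    using carr by (intro le_imp_filter_le imp_mult_le op_closed)
  also note assms(2)
  finally show ?thesis
    using carr by (simp add: filter_le_imp_iff imp_closed)
qed

lemma filter_le_map:
  assumes "x \<lesssim> y"
    and closed: "f ` carrier A \<subseteq> carrier A" and filter_closed: "f ` F \<subseteq> F"
    and mono: "\<And>u v. \<lbrakk>u \<preceq> v; u \<in> carrier A; v \<in> carrier A\<rbrakk> \<Longrightarrow> f u \<preceq> f v"
    and supermult: "\<And>u v. \<lbrakk>u \<in> carrier A; v \<in> carrier A\<rbrakk> \<Longrightarrow> f u \<otimes> f v \<preceq> f (u \<otimes> v)"
  shows "f x \<lesssim> f y"
proof -
  obtain g where g: "g \<in> F" "g \<in> carrier A" "g \<otimes> x \<preceq> y" and carr: "x \<in> carrier A" "y \<in> carrier A"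
    using assms(1) by (rule filter_leE)
  have f_carr: "f u \<in> carrier A" if "u \<in> carrier A" for u
    using closed that by blast
  have "f g \<otimes> f x \<preceq> f (g \<otimes> x)" "f (g \<otimes> x) \<preceq> f y"
    using g carr by (simp_all add: supermult mono)
  then have "f g \<otimes> f x \<preceq> f y"
    using g carr f_carr by (meson le_trans m_closed)
  then show ?thesis
    using g carr f_carr filter_closed by (blast intro: filter_leI)
qed

lemma equiv_filter_congruence: "equiv (carrier A) (filter_congruence A F)"
proof (rule equivI)
  show "filter_congruence A F \<subseteq> carrier A \<times> carrier A"
    by (auto simp: filter_congruence_def filter_le_def)
  show "refl_on (carrier A) (filter_congruence A F)"
    by (auto simp: filter_congruence_def intro!: refl_onI filter_le_refl)
  show "sym (filter_congruence A F)"
    unfolding filter_congruence_def by (rule sym_Int_converse)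
  show "trans (filter_congruence A F)"
    by (auto simp: filter_congruence_def intro!: transI intro: filter_le_trans)
qed

end

lemma filter_congruence_restrict:
  assumes "S \<subseteq> carrier A"
  shows "filter_congruence (A\<lparr>carrier := S\<rparr>) F = filter_congruence A F \<inter> (S \<times> S)"
  using assms by (auto simp: filter_congruence_def filter_le_def mv_le_def)

section \<open>Congruences of MV(I)-algebras\<close>

lemma (in mvi_algebra) box_mono:
  assumes "i \<in> I" "x \<preceq> y" "x \<in> carrier A" "y \<in> carrier A"
  shows "\<box> i x \<preceq> \<box> i y"
  using assms box_meet[of i x y] by (simp add: mv_le_def)

lemma congruence_filter_congruence:
  fixes A :: "('a, 'i) mvi_algebra"
  assumes "mvi_algebra I A" "submonoid F A" and box_F: "\<And>i. i \<in> I \<Longrightarrow> \<box>\<^bsub>A\<^esub> i ` F \<subseteq> F"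
  shows "congruence I A (filter_congruence A F)"
proof -
  interpret mvi_algebra I A by fact
  interpret submonoid F A by fact
  interpret residuated_lattice_submonoid A F ..
  have "\<box>\<^bsub>A\<^esub> i x \<lesssim> \<box>\<^bsub>A\<^esub> i y" if "i \<in> I" "x \<lesssim> y" for i x y
    using that(2)
  proof (rule filter_le_map)
    show "\<box>\<^bsub>A\<^esub> i ` carrier A \<subseteq> carrier A" "\<box>\<^bsub>A\<^esub> i ` F \<subseteq> F"
      using that(1) box_F by (auto simp: box_closed)
  qed (use that(1) in \<open>simp_all add: box_mono box_mult[symmetric] box_closed le_refl\<close>)
  then show ?thesis
    using equiv_filter_congruence filter_le_meet_mono filter_le_join_mono filter_le_mult_mono
      filter_le_imp_mono
    by (auto simp: congruence_def filter_congruence_def)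
qed

locale mvi_congruence =
  mvi_algebra I A for I :: "'i set" and A :: "('a, 'i) mvi_algebra" (structure) +
  fixes \<theta>
  assumes congruence: "congruence I A \<theta>"
begin

lemma cong_equiv: "equiv (carrier A) \<theta>"
  using congruence by (simp add: congruence_def)

lemma cong_carrier: "(x, y) \<in> \<theta> \<Longrightarrow> x \<in> carrier A" "(x, y) \<in> \<theta> \<Longrightarrow> y \<in> carrier A"
  using cong_equiv by (auto simp: equiv_def)

lemma cong_refl: "x \<in> carrier A \<Longrightarrow> (x, x) \<in> \<theta>"
  using cong_equiv by (simp add: equiv_def refl_on_def)

lemma cong_sym: "(x, y) \<in> \<theta> \<Longrightarrow> (y, x) \<in> \<theta>"
  using cong_equiv by (auto simp: equiv_def dest: symD)

lemma cong_trans: "\<lbrakk>(x, y) \<in> \<theta>; (y, z) \<in> \<theta>\<rbrakk> \<Longrightarrow> (x, z) \<in> \<theta>"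
  using cong_equiv by (auto simp: equiv_def dest: transD)

lemma
  assumes "(x, x') \<in> \<theta>" "(y, y') \<in> \<theta>"
  shows cong_meet: "(x \<curlywedge> y, x' \<curlywedge> y') \<in> \<theta>"
    and cong_mult: "(x \<otimes> y, x' \<otimes> y') \<in> \<theta>"
    and cong_imp: "(x \<leadsto> y, x' \<leadsto> y') \<in> \<theta>"
  using congruence assms by (auto simp: congruence_def)

lemma cong_box: "\<lbrakk>i \<in> I; (x, y) \<in> \<theta>\<rbrakk> \<Longrightarrow> (\<box> i x, \<box> i y) \<in> \<theta>"
  using congruence by (auto simp: congruence_def)

lemma submonoid_one_class: "submonoid (\<theta> `` {\<one>}) A"
proof
  show "\<theta> `` {\<one>} \<subseteq> carrier A"
    by (auto dest: cong_carrier)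
  show "x \<otimes> y \<in> \<theta> `` {\<one>}" if "x \<in> \<theta> `` {\<one>}" "y \<in> \<theta> `` {\<one>}" for x y
    using that cong_mult[of \<one> x \<one> y] by simp
  show "\<one> \<in> \<theta> `` {\<one>}"
    by (simp add: cong_refl)
qed

lemma box_one_class: "i \<in> I \<Longrightarrow> \<box> i ` (\<theta> `` {\<one>}) \<subseteq> \<theta> `` {\<one>}"
  using cong_box[of i \<one>] by (auto simp: box_one)

sublocale residuated_lattice_submonoid A "\<theta> `` {\<one>}"
  by (intro residuated_lattice_submonoid.intro integral_residuated_lattice_axioms
      submonoid_one_class)

lemma filter_le_one_class_imp_cong_meet:
  assumes "(x, y) \<in> filter_le A (\<theta> `` {\<one>})"
  shows "(x, x \<curlywedge> y) \<in> \<theta>"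
proof -
  obtain g where g: "g \<in> \<theta> `` {\<one>}" "g \<otimes> x \<preceq> y" and carr: "x \<in> carrier A" "y \<in> carrier A"
    using assms by (rule filter_leE)
  have x_cong: "(x, g \<otimes> x) \<in> \<theta>"
    using cong_mult[of \<one> g x x] g carr by (simp add: cong_refl)
  then have "(x \<curlywedge> y, g \<otimes> x) \<in> \<theta>"
    using cong_meet[OF x_cong cong_refl[of y]] g carr by (simp add: mv_le_def)
  then show ?thesis
    using x_cong cong_sym cong_trans by blast
qed

lemma cong_imp_filter_le_one_class:
  assumes "(x, y) \<in> \<theta>"
  shows "(x, y) \<in> filter_le A (\<theta> `` {\<one>})"
proof -
  note carr = cong_carrier[OF assms]
  have "(\<one>, x \<leadsto> y) \<in> \<theta>"
    using cong_imp[OF cong_sym[OF assms] cong_refl[of y]] carr by (simp add: imp_self)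
  then show ?thesis
    using carr by (intro filter_leI[of "x \<leadsto> y"]) (simp_all add: imp_mult_le)
qed

lemma filter_congruence_one_class: "filter_congruence A (\<theta> `` {\<one>}) = \<theta>"
proof (intro equalityI subrelI)
  fix x y assume "(x, y) \<in> filter_congruence A (\<theta> `` {\<one>})"
  then have "(x, y) \<in> filter_le A (\<theta> `` {\<one>})" "(y, x) \<in> filter_le A (\<theta> `` {\<one>})"
    by (simp_all add: filter_congruence_def)
  then have "(x, x \<curlywedge> y) \<in> \<theta>" "(y, x \<curlywedge> y) \<in> \<theta>"
    using filter_le_one_class_imp_cong_meet meet_comm filter_le_carrier by metis+
  then show "(x, y) \<in> \<theta>"
    using cong_sym cong_trans by blast
next
  fix x y assume "(x, y) \<in> \<theta>"
  then show "(x, y) \<in> filter_congruence A (\<theta> `` {\<one>})"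
    by (simp add: filter_congruence_def cong_imp_filter_le_one_class cong_sym)
qed

end

lemma mvi_algebra_subalgebra:
  assumes "mvi_algebra I B" "subalgebra I S B"
  shows "mvi_algebra I (B\<lparr>carrier := S\<rparr>)"
proof -
  interpret mvi_algebra I B by fact
  have "S \<subseteq> carrier B"
    using assms(2) by (simp add: subalgebra_def)
  note carr = subsetD[OF this]
  show ?thesis
    using assms(2)
    by unfold_locales
      (auto simp: subalgebra_def carr m_assoc meet_assoc join_assoc meet_absorb join_absorb
        zero_least one_greatest residuation imp_imp_join box_meet box_mult box_zero box_one
        intro: m_comm meet_comm join_comm)
qed

theorem theorem2:
  fixes I :: "'i set"
  shows "congruence_extension_property I (MV I :: ('a, 'i) mvi_algebra set)"
  unfolding congruence_extension_property_def
proof (intro ballI allI impI)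
  fix B :: "('a, 'i) mvi_algebra" and S \<theta>
  assume "B \<in> MV I" and S: "subalgebra I S B" and \<theta>: "congruence I (B\<lparr>carrier := S\<rparr>) \<theta>"
  then have B: "mvi_algebra I B" and SB: "S \<subseteq> carrier B"
    by (simp_all add: MV_def subalgebra_def)
  interpret S: mvi_congruence I "B\<lparr>carrier := S\<rparr>" \<theta>
    using mvi_algebra_subalgebra[OF B S] \<theta>
    by (simp add: mvi_congruence_def mvi_congruence_axioms_def)
  let ?F = "\<theta> `` {\<one>\<^bsub>B\<^esub>}"
  have "submonoid ?F B"
    using S.submonoid_one_class SB by (auto simp: submonoid_def)
  then have "congruence I B (filter_congruence B ?F)"
    using congruence_filter_congruence[OF B] S.box_one_class by simp
  moreover have "filter_congruence B ?F \<inter> (S \<times> S) = \<theta>"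
    using S.filter_congruence_one_class filter_congruence_restrict[OF SB, of ?F] by simp
  ultimately show "\<exists>\<xi>. congruence I B \<xi> \<and> \<xi> \<inter> (S \<times> S) = \<theta>"
    by blast
qed

end
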